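(* Let $d\ge 3$ be a prime. Then for any integer $a$ with $2\le a\le d-1$, the number of monomials of degree $d$ in $K[x,y,z]$ which are invariant under the action of $M_a$ is $3+\frac{d-1}{2}$.
   Context: $K$ is an algebraically closed field of characteristic zero, $e\in K$ is a primitive $d$-th root of $1$, and $M_a=\begin{pmatrix}1&0&0\\0&e&0\\0&0&e^a\end{pmatrix}$ acts on $K[x,y,z]$ by $x\mapsto x$, $y\mapsto ey$, $z\mapsto e^a z$. *)

theory Defs
  imports
    "HOL-Analysis.Analysis"
    "HOL-Library.Poly_Mapping"
    "HOL-Computational_Algebra.Computational_Algebra"
begin

text \<open>
  \<open>K[x,y,z]\<close> is the monoid algebra of the exponent vectors \<open>3 \<Rightarrow>\<^sub>0 nat\<close>, multiplication being the
  convolution product of \<open>HOL-Library.Poly_Mapping\<close>. The variables are indexed by the numeral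
  type \<open>3\<close>, the index type of 3-by-3 matrices; in that type \<open>3 = 0\<close>, and \<open>1\<close>, \<open>2\<close>, \<open>3\<close> are its
  three distinct elements.
\<close>

type_synonym 'k poly3 = "(3 \<Rightarrow>\<^sub>0 nat) \<Rightarrow>\<^sub>0 'k"

definition Const3 :: "'k::comm_ring_1 \<Rightarrow> 'k poly3"
  where "Const3 c = Poly_Mapping.single 0 c"

definition Var3 :: "3 \<Rightarrow> 'k::comm_ring_1 poly3"
  where "Var3 i = Poly_Mapping.single (Poly_Mapping.single i 1) 1"

definition subst3 :: "(3 \<Rightarrow> 'k::comm_ring_1 poly3) \<Rightarrow> 'k poly3 \<Rightarrow> 'k poly3"
  where "subst3 s p =
    (\<Sum>m\<in>Poly_Mapping.keys p.
       Const3 (Poly_Mapping.lookup p m) * (\<Prod>i\<in>UNIV. s i ^ Poly_Mapping.lookup m i))"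

text \<open>
  A matrix acts by the substitution \<open>x\<^sub>i \<mapsto> \<Sum>\<^sub>j M\<^sub>i\<^sub>j x\<^sub>j\<close>; the choice between rows and columns
  makes no difference for diagonal matrices.
\<close>

definition matrix_act :: "'k::comm_ring_1 ^ 3 ^ 3 \<Rightarrow> 'k poly3 \<Rightarrow> 'k poly3"
  where "matrix_act M = subst3 (\<lambda>i. \<Sum>j\<in>UNIV. Const3 (M $ i $ j) * Var3 j)"

definition M_mat :: "'k::field \<Rightarrow> int \<Rightarrow> 'k ^ 3 ^ 3"
  where "M_mat e a =
    vector [vector [1, 0, 0],
            vector [0, e, 0],
            vector [0, 0, e powi a]]"

definition primitive_root_of_unity :: "nat \<Rightarrow> 'k::comm_ring_1 \<Rightarrow> bool"
  where "primitive_root_of_unity d e \<longleftrightarrow> d > 0 \<and> e ^ d = 1 \<and> (\<forall>k. 0 < k \<and> k < d \<longrightarrow> e ^ k \<noteq> 1)"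

definition monomials_of_degree :: "nat \<Rightarrow> 'k::comm_ring_1 poly3 set"
  where "monomials_of_degree d =
    {Var3 1 ^ i * Var3 2 ^ j * Var3 3 ^ k | i j k. i + j + k = d}"

end

theory Submission
  imports Defs
begin

text \<open>
  A monomial \<open>x\<^sup>i y\<^sup>j z\<^sup>k\<close> is an eigenvector with eigenvalue \<open>e\<^sup>j\<^sup>+\<^sup>a\<^sup>k\<close>, so one counts the pairs
  \<open>(j, k)\<close> with \<open>j + k \<le> d\<close> and \<open>d\<close> dividing \<open>j + a k\<close>. The pure powers contribute \<open>3\<close>. For
  \<open>0 < k < d\<close> there is exactly one candidate \<open>j = r k\<close> in \<open>{1..d - 1}\<close>, and \<open>r (d - k) = d - r k\<close>;
  moreover \<open>r k + k \<noteq> d\<close> since \<open>d\<close> does not divide \<open>a - 1\<close>. Hence of \<open>k\<close> and \<open>d - k\<close> exactly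
  one satisfies \<open>r k + k \<le> d\<close>.
\<close>

section \<open>The action on monomials\<close>

lemma Const3_mult_Var3_power:
  "(Const3 c * Var3 i) ^ n = Poly_Mapping.single (Poly_Mapping.single i n) (c ^ n)"
proof (induction n)
  case (Suc n)
  then show ?case
    by (simp add: Const3_def Var3_def mult_single flip: single_add)
qed simp

lemma Var3_power:
  "Var3 i ^ n = Poly_Mapping.single (Poly_Mapping.single i n) 1"
  using Const3_mult_Var3_power[of 1 i n] by (simp add: Const3_def)

lemma prod_single:
  "finite A \<Longrightarrow> (\<Prod>i\<in>A. Poly_Mapping.single (f i) (c i)) = Poly_Mapping.single (\<Sum>i\<in>A. f i) (\<Prod>i\<in>A. c i)"
  for c :: "'a \<Rightarrow> 'b::comm_ring_1" and f :: "'a \<Rightarrow> 'c::comm_monoid_add"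
  by (induction A rule: finite_induct) (simp_all add: mult_single)

lemma sum_single_lookup:
  "(\<Sum>i\<in>UNIV. Poly_Mapping.single i (Poly_Mapping.lookup m i)) = m"
  for m :: "'a::finite \<Rightarrow>\<^sub>0 'b::comm_monoid_add"
  by (rule poly_mapping_eqI) (simp add: lookup_sum lookup_single when_def)

text \<open>A diagonal matrix rescales each variable. The scalars factor out of the product of
  powers, and \<open>sum_single_lookup\<close> reassembles the remaining variable powers into the
  exponent vector \<open>m\<close>.\<close>

lemma matrix_act_diagonal_monomial:
  fixes M :: "'k::comm_ring_1 ^ 3 ^ 3"
  assumes diag: "\<And>i j. i \<noteq> j \<Longrightarrow> M $ i $ j = 0"
  shows "matrix_act M (Poly_Mapping.single m 1)
    = Poly_Mapping.single m (\<Prod>i\<in>UNIV. M $ i $ i ^ Poly_Mapping.lookup m i)"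
proof -
  have row: "(\<Sum>j\<in>UNIV. Const3 (M $ i $ j) * Var3 j) = Const3 (M $ i $ i) * Var3 i" for i
  proof -
    have "(\<Sum>j\<in>UNIV. Const3 (M $ i $ j) * Var3 j)
        = (\<Sum>j\<in>UNIV. if j = i then Const3 (M $ i $ i) * Var3 i else 0)"
      by (rule sum.cong) (auto simp: diag Const3_def)
    then show ?thesis by simp
  qed
  show ?thesis
    unfolding matrix_act_def subst3_def row Const3_mult_Var3_power
    by (simp add: prod_single sum_single_lookup Const3_def)
qed

definition expo3 :: "nat \<Rightarrow> nat \<Rightarrow> nat \<Rightarrow> 3 \<Rightarrow>\<^sub>0 nat"
  where "expo3 i j k = Poly_Mapping.single 1 i + Poly_Mapping.single 2 j + Poly_Mapping.single 3 k"

lemma lookup_expo3: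
  "Poly_Mapping.lookup (expo3 i j k) 1 = i"
  "Poly_Mapping.lookup (expo3 i j k) 2 = j"
  "Poly_Mapping.lookup (expo3 i j k) 3 = k"
  by (simp_all add: expo3_def lookup_add lookup_single when_def)

lemma expo3_eq_iff: "expo3 i j k = expo3 i' j' k' \<longleftrightarrow> i = i' \<and> j = j' \<and> k = k'"
  by (metis lookup_expo3)

lemma Var3_monomial:
  "Var3 1 ^ i * Var3 2 ^ j * Var3 3 ^ k = Poly_Mapping.single (expo3 i j k) 1"
  by (simp add: Var3_power mult_single expo3_def)

lemma single_eq_single_iff:
  "Poly_Mapping.single m c = Poly_Mapping.single m c' \<longleftrightarrow> c = c'"
  by (metis lookup_single_eq)

lemma single_one_eq_iff:
  "Poly_Mapping.single m (1::'b::zero_neq_one) = Poly_Mapping.single m' 1 \<longleftrightarrow> m = m'"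
  by (metis lookup_single_eq lookup_single_not_eq zero_neq_one)

lemma matrix_act_M_mat:
  "matrix_act (M_mat e a) (Poly_Mapping.single (expo3 i j k) 1)
    = Poly_Mapping.single (expo3 i j k) (e ^ j * (e powi a) ^ k)"
proof -
  have diag: "\<forall>i j. i \<noteq> j \<longrightarrow> M_mat e a $ i $ j = 0"
    by (simp add: forall_3 M_mat_def)
  have "(\<Prod>l\<in>UNIV. M_mat e a $ l $ l ^ Poly_Mapping.lookup (expo3 i j k) l) = e ^ j * (e powi a) ^ k"
    unfolding UNIV_3 by (simp add: lookup_expo3 M_mat_def)
  then show ?thesis
    using matrix_act_diagonal_monomial[of "M_mat e a" "expo3 i j k"] diag by metis
qed

lemma primitive_root_power_eq_1_iff:
  assumes "primitive_root_of_unity d e"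
  shows "e ^ n = 1 \<longleftrightarrow> d dvd n"
proof -
  have d: "d > 0" "e ^ d = 1" and prim: "\<And>k. 0 < k \<Longrightarrow> k < d \<Longrightarrow> e ^ k \<noteq> 1"
    using assms by (auto simp: primitive_root_of_unity_def)
  have "e ^ n = e ^ (d * (n div d) + n mod d)" by simp
  also have "\<dots> = e ^ (n mod d)" by (simp only: power_add power_mult d power_one mult_1)
  finally have "e ^ n = e ^ (n mod d)" .
  then show ?thesis
    using prim[of "n mod d"] d by (auto simp: dvd_eq_mod_eq_0)
qed

section \<open>Counting the exponents\<close>

text \<open>The candidate \<open>j = r k\<close> from above is \<open>d - (b * k) mod d\<close>.\<close>

lemma card_reflection_half:
  fixes b d :: nat
  assumes "prime d" "odd d" "2 \<le> b" "b < d"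
  shows "card {k \<in> {1..<d}. k \<le> (b * k) mod d} = (d - 1) div 2"
proof -
  let ?S = "{k \<in> {1..<d}. k \<le> (b * k) mod d}"
  have refl: "(b * (d - k)) mod d = d - (b * k) mod d" and neq: "(b * k) mod d \<noteq> k"
    if k: "k \<in> {1..<d}" for k
  proof -
    \<comment> \<open>Applied twice: \<open>c = b - 1\<close> shows that \<open>b * k\<close> and
      \<open>k\<close> are incongruent mod \<open>d\<close>, and \<open>c = b\<close> shows that the
      residue of \<open>b * k\<close> is nonzero.\<close>
    have ndvd: "\<not> d dvd c * k" if "0 < c" "c < d" for c
      using assms(1) k that by (auto simp: prime_dvd_mult_iff dest: dvd_imp_le)
    have "\<not> d dvd (b - 1) * k" using ndvd[of "b - 1"] assms by simp
    then have "(b * k) mod d \<noteq> k mod d"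
      using mod_eq_dvd_iff_nat[of k "b * k" d] assms by (auto simp: diff_mult_distrib)
    then show "(b * k) mod d \<noteq> k" using k by simp
    have pos: "(b * k) mod d \<noteq> 0" using ndvd[of b] assms by (simp add: dvd_eq_mod_eq_0)
    \<comment> \<open>The residues of \<open>b * (d - k)\<close> and \<open>b * k\<close> add up to
      a multiple of \<open>d\<close> lying strictly between 0 and \<open>2 * d\<close>, hence to
      \<open>d\<close> itself.\<close>
    have "b * (d - k) + b * k = b * d"
      using k by (metis add_mult_distrib2 atLeastLessThan_iff le_add_diff_inverse2 less_imp_le)
    then have "((b * (d - k)) mod d + (b * k) mod d) mod d = 0"
      by (simp add: mod_add_eq)
    then have "d dvd (b * (d - k)) mod d + (b * k) mod d" by auto
    then obtain q where q: "(b * (d - k)) mod d + (b * k) mod d = d * q" by (elim dvdE)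
    have "(b * (d - k)) mod d < d" "(b * k) mod d < d" using k by auto
    then have "d * q < d * 2" "d * q > 0" using q pos by linarith+
    then have "q = 1" by simp
    then show "(b * (d - k)) mod d = d - (b * k) mod d" using q by simp
  qed
  \<comment> \<open>With s the residue of \<open>b * k\<close>, membership of \<open>d - k\<close>
    reads d - k \<le> d - s, that is s \<le> k. As s and k differ, this is the negation of k \<le>
    s.\<close>
  have swap: "d - k \<in> ?S \<longleftrightarrow> k \<notin> ?S" if k: "k \<in> {1..<d}" for k
  proof -
    have "(b * k) mod d < d" using k by simp
    then show ?thesis using refl[OF k] neq[OF k] k by auto
  qed
  have "bij_betw (\<lambda>k. d - k) ?S ({1..<d} - ?S)"
  proof (rule bij_betwI[where g = "\<lambda>k. d - k"])
    show "(\<lambda>k. d - k) \<in> ?S \<rightarrow> {1..<d} - ?S"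
      using swap by fastforce
    show "(\<lambda>k. d - k) \<in> {1..<d} - ?S \<rightarrow> ?S"
      using swap by blast
  qed auto
  then have "card ?S = card ({1..<d} - ?S)" by (rule bij_betw_same_card)
  moreover have "card ({1..<d} - ?S) = card {1..<d} - card ?S"
    by (rule card_Diff_subset) auto
  moreover have "card ?S \<le> card {1..<d}" by (rule card_mono) auto
  ultimately show ?thesis by simp
qed

text \<open>The three explicit pairs belong to the pure powers of x, y and z; they are the solutions
  with \<open>k = 0\<close> or \<open>k = d\<close>. For k strictly between, substituting j = d - s,
  where s is the residue of \<open>b * k\<close>, turns j + k \<le> d into k \<le> s.\<close>

lemma exponent_pairs_eq:
  fixes b d :: nat
  assumes "prime d" "2 \<le> b" "b < d"
  shows "{(j, k). j + k \<le> d \<and> d dvd j + b * k}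
    = {(0, 0), (d, 0), (0, d)}
      \<union> (\<lambda>k. (d - (b * k) mod d, k)) ` {k \<in> {1..<d}. k \<le> (b * k) mod d}"
    (is "?L = ?R")
proof (rule set_eqI, clarify)
  fix j k
  have d: "d > 0" using assms by simp
  have mod: "(j + b * k) mod d = (j + (b * k) mod d) mod d" by (simp add: mod_add_right_eq)
  consider "k = 0" | "0 < k" "k < d" | "k = d" | "k > d" by linarith
  then show "(j, k) \<in> ?L \<longleftrightarrow> (j, k) \<in> ?R"
  proof cases
    case 1
    then show ?thesis using d by (auto dest: dvd_imp_le)
  next
    case 2
    have r: "0 < (b * k) mod d" "(b * k) mod d < d"
      using assms 2 d by (auto simp: prime_dvd_mult_iff mod_greater_zero_iff_not_dvd dest: dvd_imp_le)
    have "d dvd j + b * k \<longleftrightarrow> d dvd j + (b * k) mod d"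
      by (simp add: dvd_eq_mod_eq_0 mod)
    also have "\<dots> \<longleftrightarrow> j = d - (b * k) mod d" if "j + k \<le> d"
    proof
      assume "d dvd j + (b * k) mod d"
      then obtain q where q: "j + (b * k) mod d = d * q" by (elim dvdE)
      \<comment> \<open>Since k is positive, j + k \<le> d gives j < d, so adding a residue below
        \<open>d\<close> stays below \<open>2 * d\<close>.\<close>
      then have "d * q < d * 2" "d * q > 0" using r that by linarith+
      then have "q = 1" by simp
      then show "j = d - (b * k) mod d" using q by simp
    qed (use r in simp)
    finally have "(j, k) \<in> ?L \<longleftrightarrow> j + k \<le> d \<and> j = d - (b * k) mod d" by blast
    then show ?thesis using 2 r by auto
  next
    case 3
    then show ?thesis by auto
  next
    case 4
    then show ?thesis by auto
  qed
qed

lemma card_exponent_pairs: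
  fixes b d :: nat
  assumes "prime d" "odd d" "2 \<le> b" "b < d"
  shows "card {(j, k). j + k \<le> d \<and> d dvd j + b * k} = 3 + (d - 1) div 2"
proof -
  let ?S = "{k \<in> {1..<d}. k \<le> (b * k) mod d}"
  let ?f = "\<lambda>k. (d - (b * k) mod d, k)"
  \<comment> \<open>Second components separate the two sets: they are 0 or \<open>d\<close> on the
    left and strictly between on the right.\<close>
  have "card ({(0, 0), (d, 0), (0, d)} \<union> ?f ` ?S) = card {(0, 0), (d, 0), (0, d)} + card (?f ` ?S)"
    by (rule card_Un_disjoint) auto
  also have "card (?f ` ?S) = card ?S" by (rule card_image) (auto intro: inj_onI)
  also have "card {(0, 0), (d, 0), (0, d)} = 3" using assms by auto
  finally show ?thesis
    unfolding exponent_pairs_eq[OF assms(1,3,4)] card_reflection_half[OF assms] .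
qed

theorem theorem5p12:
  fixes e :: "'k::{alg_closed_field, field_char_0}"
    and d :: nat
    and a :: int
  assumes "prime d" and "d \<ge> 3"
    and "primitive_root_of_unity d e"
    and "2 \<le> a" and "a \<le> int d - 1"
  shows "card {m \<in> (monomials_of_degree d :: 'k poly3 set). matrix_act (M_mat e a) m = m}
           = 3 + (d - 1) div 2"
proof -
  \<comment> \<open>A natural exponent \<open>b\<close> turns \<open>powi\<close> into an ordinary
    power, so the eigenvalue becomes \<open>e ^ (j + b * k)\<close>.\<close>
  obtain b where a: "a = int b" using assms by (metis zero_le_imp_eq_int order_trans zero_le_numeral)
  have b: "2 \<le> b" "b < d" using assms a by auto
  have "odd d" using prime_odd_nat[of d] assms by simp
  let ?P = "{(j, k). j + k \<le> d \<and> d dvd j + b * k}"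
  \<comment> \<open>The degree fixes the exponent of x; on \<open>?P\<close> the bound j + k \<le> d
    keeps the natural subtraction from truncating.\<close>
  let ?g = "\<lambda>(j, k). Poly_Mapping.single (expo3 (d - j - k) j k) 1 :: 'k poly3"
  have inv: "matrix_act (M_mat e a) (Poly_Mapping.single (expo3 i j k) 1)
      = Poly_Mapping.single (expo3 i j k) 1 \<longleftrightarrow> d dvd j + b * k" for i j k
    using primitive_root_power_eq_1_iff[OF assms(3)]
    by (simp add: matrix_act_M_mat single_eq_single_iff a flip: power_mult power_add)
  have "{m \<in> (monomials_of_degree d :: 'k poly3 set). matrix_act (M_mat e a) m = m} = ?g ` ?P"
  proof (intro equalityI subsetI)
    fix m assume "m \<in> {m \<in> (monomials_of_degree d :: 'k poly3 set). matrix_act (M_mat e a) m = m}"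
    then obtain i j k where "m = Poly_Mapping.single (expo3 i j k) 1" "i + j + k = d" "d dvd j + b * k"
      by (auto simp: monomials_of_degree_def Var3_monomial inv)
    then show "m \<in> ?g ` ?P" by (intro image_eqI[where x = "(j, k)"]) auto
  next
    fix m assume "m \<in> ?g ` ?P"
    then obtain j k where m: "m = Poly_Mapping.single (expo3 (d - j - k) j k) 1"
      and jk: "j + k \<le> d" "d dvd j + b * k"
      by auto
    have "m \<in> monomials_of_degree d"
      unfolding monomials_of_degree_def Var3_monomial m
      by (intro CollectI exI[where x = "d - j - k"] exI[where x = j] exI[where x = k] conjI refl)
        (use jk in simp)
    then show "m \<in> {m \<in> (monomials_of_degree d :: 'k poly3 set). matrix_act (M_mat e a) m = m}"
      using m jk by (simp add: inv)
  qed
  moreover have "inj_on ?g ?P"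
    by (auto simp: inj_on_def single_one_eq_iff expo3_eq_iff)
  ultimately show ?thesis
    using card_exponent_pairs[OF assms(1) \<open>odd d\<close> b] by (simp add: card_image)
qed

end
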